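(* Let $a,b,c,d\in\mathbb{C}$ with $c\notin\mathbb{Z}_{\leqslant 0}$, $d\notin\mathbb{Z}$, $b-d\notin\mathbb{Z}_{\geqslant0}$, and let $z\in\mathbb{C}$, $z\neq0$. Then for any positive integer $N$, $${}_2F_2\biggl[\begin{matrix}a,b-n\\ c,d-n\end{matrix};z\biggr]=\sum_{k=0}^{N-1}\frac{(a)_k(d-b)_k}{(c)_k(d-n)_k}\frac{(-z)^k}{k!}\,{}_1F_1\biggl[\begin{matrix}a+k\\ c+k\end{matrix};z\biggr]+\mathcal{O}\bigl(n^{-N}\bigr)$$ as $n\to+\infty$ through integer values (with $a,b,c,d,z,N$ fixed).
   Context: $(\cdot)_k$ is the Pochhammer symbol and ${}_pF_q\bigl[\begin{smallmatrix}a_1,\dots,a_p\\ b_1,\dots,b_q\end{smallmatrix};z\bigr]=\sum_{n=0}^{\infty}\frac{(a_1)_n\cdots(a_p)_n}{(b_1)_n\cdots(b_q)_n}\frac{z^n}{n!}$ is the generalized hypergeometric function, with $a_j\in\mathbb{C}$ and $b_j\in\mathbb{C}\setminus\mathbb{Z}_{\leqslant0}$. *)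

theory Defs
  imports "HOL-Analysis.Analysis" "HOL-Library.Landau_Symbols" "HOL-Library.Nonpos_Ints"
begin

text \<open>
  The generalized hypergeometric function \<open>pFq[as; bs; z]\<close>, with \<open>p = length as\<close> and
  \<open>q = length bs\<close>. It is meaningful when no element of \<open>bs\<close> is a non-positive integer and the
  series converges; for \<open>p \<le> q\<close> it converges for every \<open>z\<close>.
\<close>
definition hypergeo :: "complex list \<Rightarrow> complex list \<Rightarrow> complex \<Rightarrow> complex" where
  "hypergeo as bs z =
     (\<Sum>n. (\<Prod>a\<leftarrow>as. pochhammer a n) / (\<Prod>b\<leftarrow>bs. pochhammer b n) * z ^ n / fact n)"

lemma hypergeo_eq_eval_fps: "hypergeo as bs z = eval_fps (fps_hypergeo as bs 1) z"
proof -
  have "foldr (\<lambda>a r. r * pochhammer a n) xs (c :: complex) = c * (\<Prod>a\<leftarrow>xs. pochhammer a n)"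
    for xs c n by (induction xs) (simp_all add: algebra_simps)
  then show ?thesis
    unfolding hypergeo_def eval_fps_def fps_hypergeo_nth_alt by (simp add: field_simps)
qed

end

theory Submission
  imports Defs
begin

text \<open>
  By Chu--Vandermonde the ratio \<open>(b - n)\<^sub>m / (d - n)\<^sub>m\<close> equals the sum over \<open>k \<le> m\<close> of
  \<open>(m choose k) (-1)^k (d - b)\<^sub>k / (d - n)\<^sub>k\<close>, whose \<open>k\<close>-th summand is \<open>O(n^(-k))\<close>. Inserted in
  the \<open>2F2\<close> series, the part with index \<open>k\<close> sums over \<open>m\<close> to a multiple of a shifted \<open>1F1\<close>
  series, so the terms with \<open>k < N\<close> give precisely the stated sum and the error is an explicit
  series containing only \<open>k \<ge> N\<close> (\<open>hypergeo_2F2_remainder_sums\<close>).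

  Each summand with \<open>k \<ge> N\<close> contains the factor \<open>1 / (d - n)\<^sub>N\<close>, which is \<open>O(n^(-N))\<close>. What remains
  is to bound the rest uniformly in \<open>n\<close>. The danger is that for \<open>k > n\<close> the symbol \<open>(d - n)\<^sub>k\<close>
  runs past the origin and has many moderate factors. But \<open>d\<close> is not an integer, so
  \<open>|d + j| \<ge> \<delta> (1 + |j|)\<close> for all integers \<open>j\<close> and some \<open>\<delta> > 0\<close>, and this forces
  \<open>|(d + j)\<^sub>m| \<ge> (\<delta>/2)^m m!\<close> for every integer \<open>j\<close> (\<open>norm_pochhammer_int_shift_ge\<close>). Consequently
  the quotients \<open>(d - b)\<^sub>k / (d - n)\<^sub>k\<close> are at most \<open>K C^k / |(d - n)\<^sub>N|\<close> with \<open>K\<close> and \<open>C\<close> free of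
  \<open>n\<close>. By the binomial theorem the inner sum over \<open>k\<close> is then at most \<open>K (C + 1)^m / |(d - n)\<^sub>N|\<close>,
  and since \<open>(a)\<^sub>m / (c)\<^sub>m\<close> also grows at most geometrically, the factor \<open>1 / m!\<close> makes the whole
  error series converge like an exponential series.
\<close>

section \<open>Growth of Pochhammer symbols\<close>

text \<open>
  Applied to the integers and to the non-positive integers, this is the quantitative form of the
  hypotheses on \<open>d\<close> and \<open>c\<close>: \<open>norm (x - s)\<close> is bounded away from zero because \<open>S\<close> is closed, and
  for large \<open>s\<close> it is comparable to \<open>norm s\<close>.
\<close>
lemma dist_closed_set_linear_bound:
  fixes x :: "'a :: {real_normed_vector, heine_borel}"
  assumes "closed S" "x \<notin> S"
  shows "\<exists>\<delta>>0. \<forall>s\<in>S. \<delta> * (1 + norm s) \<le> norm (x - s)"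
proof -
  obtain e where e: "e > 0" "\<And>s. s \<in> S \<Longrightarrow> e \<le> dist x s"
    using separate_point_closed[OF assms] by blast
  have "e / (1 + e + norm x) * (1 + norm s) \<le> norm (x - s)" if "s \<in> S" for s
  proof -
    have r: "e \<le> norm (x - s)" using e(2)[OF that] by (simp add: dist_norm)
    have "norm s \<le> norm x + norm (x - s)"
      using norm_triangle_ineq4[of x "x - s"] by simp
    then have "e * (1 + norm s) \<le> e * (1 + norm x) + e * norm (x - s)"
      using e(1) by (simp flip: distrib_left)
    also have "e * (1 + norm x) \<le> norm (x - s) * (1 + norm x)"
      by (intro mult_right_mono r) simp
    finally have "e * (1 + norm s) \<le> norm (x - s) * (1 + e + norm x)"
      by (simp add: algebra_simps)
    moreover have "1 + e + norm x > 0" using e(1) norm_ge_zero[of x] by linarith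
    ultimately show ?thesis by (simp add: field_simps)
  qed
  moreover have "e / (1 + e + norm x) > 0"
    using e(1) norm_ge_zero[of x] by (intro divide_pos_pos) linarith+
  ultimately show ?thesis by blast
qed

lemma norm_pochhammer_le:
  fixes a :: "'a :: real_normed_field"
  shows "norm (pochhammer a m) \<le> (norm a + 1) ^ m * fact m"
proof (induction m)
  case (Suc m)
  have "norm (a + of_nat m) \<le> norm a + real m"
    using norm_triangle_ineq[of a "of_nat m"] by simp
  also have "\<dots> \<le> (norm a + 1) * real (Suc m)"
    by (simp add: algebra_simps)
  finally have "norm (pochhammer a m) * norm (a + of_nat m)
      \<le> ((norm a + 1) ^ m * fact m) * ((norm a + 1) * real (Suc m))"
    by (intro mult_mono Suc.IH) auto
  then show ?case by (simp add: pochhammer_Suc norm_mult mult_ac)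
qed simp

lemma norm_pochhammer_ge:
  fixes c :: "'a :: real_normed_field"
  assumes "\<delta> > 0" "\<And>i::nat. \<delta> * (1 + real i) \<le> norm (c + of_nat i)"
  shows "\<delta> ^ m * fact m \<le> norm (pochhammer c m)"
proof (induction m)
  case (Suc m)
  have "(\<delta> ^ m * fact m) * (\<delta> * (1 + real m)) \<le> norm (pochhammer c m) * norm (c + of_nat m)"
    using assms(1) by (intro mult_mono Suc.IH assms(2)) auto
  then show ?case by (simp add: pochhammer_Suc norm_mult mult_ac)
qed simp

text \<open>
  A product of \<open>m\<close> consecutive integer translates of \<open>d\<close> is smallest when the translates surround
  \<open>d\<close>, and even then only the factor \<open>2 ^ m\<close> is lost against \<open>m!\<close>. In the
  induction one end factor is split off from \<open>m + 1\<close> of them: the integers at the two ends are \<open>m\<close>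
  apart, so at least one of these factors has norm \<open>\<delta> (m + 1) / 2\<close> or more.
\<close>
lemma norm_pochhammer_int_shift_ge:
  fixes d :: "'a :: real_normed_field"
  assumes "\<delta> > 0" "\<And>j::int. \<delta> * (1 + \<bar>real_of_int j\<bar>) \<le> norm (d + of_int j)"
  shows "(\<delta> / 2) ^ m * fact m \<le> norm (pochhammer (d + of_int j) m)"
proof (induction m arbitrary: j)
  case (Suc m)
  let ?first = "norm (d + of_int j)" and ?last = "norm (d + of_int (j + int m))"
  have step: "(\<delta> / 2) ^ Suc m * fact (Suc m) \<le> f * p"
    if "\<delta> / 2 * (1 + real m) \<le> f" "(\<delta> / 2) ^ m * fact m \<le> p" for f p
  proof -
    have "0 \<le> \<delta> / 2 * (1 + real m)" "0 \<le> (\<delta> / 2) ^ m * fact m"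
      using assms(1) by simp_all
    with that have "(\<delta> / 2 * (1 + real m)) * ((\<delta> / 2) ^ m * fact m) \<le> f * p"
      by (meson mult_mono order_trans)
    then show ?thesis by (simp add: mult_ac)
  qed
  have "\<delta> * (1 + real m) \<le> \<delta> * (1 + \<bar>real_of_int j\<bar>) + \<delta> * (1 + \<bar>real_of_int (j + int m)\<bar>)"
    unfolding distrib_left[symmetric] using assms(1) by (intro mult_left_mono) auto
  also have "\<dots> \<le> ?first + ?last"
    by (intro add_mono assms(2))
  finally consider "\<delta> / 2 * (1 + real m) \<le> ?first" | "\<delta> / 2 * (1 + real m) \<le> ?last"
    by linarith
  then show ?case
  proof cases
    case 1
    have "pochhammer (d + of_int j) (Suc m) = (d + of_int j) * pochhammer (d + of_int (j + 1)) m"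
      by (simp add: pochhammer_rec add_ac)
    then show ?thesis using step[OF 1 Suc.IH[of "j + 1"]] by (simp add: norm_mult)
  next
    case 2
    have "pochhammer (d + of_int j) (Suc m)
        = (d + of_int (j + int m)) * pochhammer (d + of_int j) m"
      by (simp add: pochhammer_rec' add_ac)
    then show ?thesis using step[OF 2 Suc.IH[of j]] by (simp add: norm_mult)
  qed
qed simp

lemma norm_pochhammer_ratio_le:
  fixes a c :: complex
  assumes "c \<notin> \<int>\<^sub>\<le>\<^sub>0"
  shows "\<exists>M\<ge>0. \<forall>m. norm (pochhammer a m / pochhammer c m) \<le> M ^ m"
proof -
  obtain \<delta> where \<delta>: "\<delta> > 0" "\<And>s. s \<in> \<int>\<^sub>\<le>\<^sub>0 \<Longrightarrow> \<delta> * (1 + norm s) \<le> norm (c - s)"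
    using dist_closed_set_linear_bound[OF closed_nonpos_Ints assms] by blast
  have "\<delta> * (1 + real i) \<le> norm (c + of_nat i)" for i :: nat
    using \<delta>(2)[of "- of_nat i"] by simp
  note lower = norm_pochhammer_ge[OF \<delta>(1) this]
  have "norm (pochhammer a m / pochhammer c m) \<le> ((norm a + 1) / \<delta>) ^ m" for m
  proof -
    have "norm (pochhammer a m / pochhammer c m) \<le> ((norm a + 1) ^ m * fact m) / (\<delta> ^ m * fact m)"
      unfolding norm_divide using \<delta>(1) lower
      by (intro frac_le norm_pochhammer_le) auto
    then show ?thesis by (simp add: power_divide)
  qed
  moreover have "(norm a + 1) / \<delta> \<ge> 0" using \<delta>(1) by simp
  ultimately show ?thesis by blast
qed

text \<open>
  The estimate that makes the error uniform: after the first \<open>N\<close> factors, which carry the decay in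
  \<open>n\<close>, are split off, the remaining ratio is bounded geometrically by constants free of \<open>n\<close>.
\<close>
lemma pochhammer_ratio_shift_le:
  fixes u d :: complex
  assumes "d \<notin> \<int>"
  shows "\<exists>K\<ge>0. \<exists>C\<ge>0. \<forall>n k. N \<le> k \<longrightarrow>
           norm (pochhammer u k / pochhammer (d - of_nat n) k)
             \<le> K * C ^ k / norm (pochhammer (d - of_nat n) N)"
proof -
  obtain \<delta> where \<delta>: "\<delta> > 0" "\<And>s. s \<in> \<int> \<Longrightarrow> \<delta> * (1 + norm s) \<le> norm (d - s)"
    using dist_closed_set_linear_bound[OF closed_Ints assms] by blast
  have "\<delta> * (1 + \<bar>real_of_int j\<bar>) \<le> norm (d + of_int j)" for j :: int
    using \<delta>(2)[of "- of_int j"] by simp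
  note lower = norm_pochhammer_int_shift_ge[OF \<delta>(1) this]
  define v where "v = u + of_nat N"
  \<comment> \<open>The summand \<open>1\<close> only serves to have \<open>C ^ (k - N) \<le> C ^ k\<close>.\<close>
  define C where "C = 1 + (norm v + 1) / (\<delta> / 2)"
  define K where "K = norm (pochhammer u N)"
  have C: "C \<ge> 1" "(norm v + 1) / (\<delta> / 2) \<le> C" using \<delta>(1) by (auto simp: C_def)
  have "norm (pochhammer u k / pochhammer (d - of_nat n) k)
          \<le> K * C ^ k / norm (pochhammer (d - of_nat n) N)" if "N \<le> k" for n k
  proof -
    obtain j where k: "k = N + j" using \<open>N \<le> k\<close> by (auto simp: le_iff_add)
    define w where "w = d + of_int (int N - int n)"
    have "norm (pochhammer v j / pochhammer w j)
        \<le> ((norm v + 1) ^ j * fact j) / ((\<delta> / 2) ^ j * fact j)"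
      unfolding norm_divide w_def using \<delta>(1)
      by (intro frac_le norm_pochhammer_le lower) auto
    also have "\<dots> = ((norm v + 1) / (\<delta> / 2)) ^ j"
      by (simp only: power_divide[of _ "\<delta> / 2"] mult_divide_mult_cancel_right[OF fact_nonzero])
    also have "\<dots> \<le> C ^ j"
      using C(2) \<delta>(1) by (intro power_mono) auto
    also have "\<dots> \<le> C ^ k"
      using C(1) by (intro power_increasing) (auto simp: k)
    finally have *: "norm (pochhammer v j / pochhammer w j) \<le> C ^ k" .
    have "pochhammer u k / pochhammer (d - of_nat n) k
        = pochhammer u N / pochhammer (d - of_nat n) N * (pochhammer v j / pochhammer w j)"
      by (simp add: k pochhammer_product' v_def w_def algebra_simps)
    then have "norm (pochhammer u k / pochhammer (d - of_nat n) k)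
        = K / norm (pochhammer (d - of_nat n) N) * norm (pochhammer v j / pochhammer w j)"
      by (simp add: K_def norm_mult norm_divide)
    also have "\<dots> \<le> K / norm (pochhammer (d - of_nat n) N) * C ^ k"
      by (intro mult_left_mono *) (simp add: K_def)
    finally show ?thesis by simp
  qed
  moreover have "K \<ge> 0" "C \<ge> 0" using C by (auto simp: K_def)
  ultimately show ?thesis by blast
qed

lemma norm_pochhammer_minus_nat_ge:
  fixes d :: complex
  assumes "real n \<ge> 2 * (norm d + real N)"
  shows "(real n / 2) ^ N \<le> norm (pochhammer (d - of_nat n) N)"
proof -
  have "real n / 2 \<le> norm (d - of_nat n + of_nat i)" if "i < N" for i
  proof -
    have "real n = norm (d + of_nat i - (d - of_nat n + of_nat i))" by simp
    also have "\<dots> \<le> norm (d + of_nat i) + norm (d - of_nat n + of_nat i)"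
      by (rule norm_triangle_ineq4)
    also have "norm (d + of_nat i) \<le> norm d + real i"
      using norm_triangle_ineq[of d "of_nat i"] by simp
    finally show ?thesis using assms that by simp
  qed
  then have "(\<Prod>i<N. real n / 2) \<le> (\<Prod>i<N. norm (d - of_nat n + of_nat i))"
    by (intro prod_mono) auto
  then show ?thesis by (simp add: pochhammer_prod prod_norm lessThan_atLeast0)
qed

section \<open>The expansion with exact remainder\<close>

text \<open>Chu--Vandermonde, read as the expansion of a ratio of Pochhammer symbols.\<close>
lemma pochhammer_ratio_expansion:
  fixes b d :: complex
  assumes "d \<notin> \<int>\<^sub>\<le>\<^sub>0"
  shows "pochhammer b m / pochhammer d m
    = (\<Sum>k\<le>m. of_nat (m choose k) * ((-1) ^ k * pochhammer (d - b) k / pochhammer d k))"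
proof -
  have "\<forall>i\<in>{0..<m}. d \<noteq> - of_nat i"
    using assms minus_of_nat_in_nonpos_Ints by blast
  from Vandermonde_pochhammer[OF this, of "d - b"]
  have "pochhammer b m / pochhammer d m
    = (\<Sum>k\<in>{0..m}. pochhammer (d - b) k * pochhammer (- of_nat m) k / (fact k * pochhammer d k))"
    by simp
  also have "\<dots> = (\<Sum>k\<le>m. of_nat (m choose k) * ((-1) ^ k * pochhammer (d - b) k / pochhammer d k))"
    by (intro sum.cong)
       (auto simp: binomial_gbinomial gbinomial_pochhammer simp flip: power_add)
  finally show ?thesis .
qed

lemma summable_pochhammer_ratio:
  fixes a c z :: complex
  assumes "c \<notin> \<int>\<^sub>\<le>\<^sub>0" and g: "\<And>m. norm (g m) \<le> B ^ m"
  shows "summable (\<lambda>m. pochhammer a m / pochhammer c m * z ^ m / fact m * g m)"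
proof -
  obtain M where M: "M \<ge> 0" "\<And>m. norm (pochhammer a m / pochhammer c m) \<le> M ^ m"
    using norm_pochhammer_ratio_le[OF assms(1)] by blast
  show ?thesis
  proof (rule summable_comparison_test')
    show "summable (\<lambda>m. inverse (fact m) * (M * norm z * B) ^ m)" by (rule summable_exp)
    fix m :: nat
    have "norm (pochhammer a m / pochhammer c m * z ^ m / fact m * g m)
        = norm (pochhammer a m / pochhammer c m) * (norm z ^ m / fact m) * norm (g m)"
      by (simp add: norm_mult norm_divide norm_power)
    also have "\<dots> \<le> M ^ m * (norm z ^ m / fact m) * B ^ m"
      using M by (intro mult_mono g) auto
    finally show "norm (pochhammer a m / pochhammer c m * z ^ m / fact m * g m)
        \<le> inverse (fact m) * (M * norm z * B) ^ m"
      by (simp add: power_mult_distrib field_simps)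
  qed
qed

lemma hypergeo_1F1_shift_sums:
  fixes a c z :: complex
  assumes "c \<notin> \<int>\<^sub>\<le>\<^sub>0"
  shows "(\<lambda>m. pochhammer a m / pochhammer c m * z ^ m / fact m * of_nat (m choose k)) sums
    (pochhammer a k / pochhammer c k * (z ^ k / fact k) * hypergeo [a + of_nat k] [c + of_nat k] z)"
proof -
  let ?t = "\<lambda>m. pochhammer (a + of_nat k) m / pochhammer (c + of_nat k) m * z ^ m / fact m"
  let ?p = "pochhammer a k / pochhammer c k * (z ^ k / fact k)"
  have "c + of_nat k \<notin> \<int>\<^sub>\<le>\<^sub>0"
    using assms nonpos_Ints_diff_Nats[of "c + of_nat k" "of_nat k"] by auto
  then have "summable ?t"
    using summable_pochhammer_ratio[of _ "\<lambda>_. 1" 1] by simp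
  then have "(\<lambda>m. ?p * ?t m) sums (?p * hypergeo [a + of_nat k] [c + of_nat k] z)"
    by (intro sums_mult) (simp add: hypergeo_def summable_sums)
  also have "(\<lambda>m. ?p * ?t m) = (\<lambda>m. pochhammer a (m + k) / pochhammer c (m + k)
      * z ^ (m + k) / fact (m + k) * of_nat ((m + k) choose k))"
  proof
    fix m
    have poch: "pochhammer x (m + k) = pochhammer x k * pochhammer (x + of_nat k) m" for x :: complex
      by (metis add.commute pochhammer_product')
    have "of_nat ((m + k) choose k) = (fact (m + k) / (fact k * fact m) :: complex)"
      by (simp add: binomial_fact)
    then show "?p * ?t m = pochhammer a (m + k) / pochhammer c (m + k)
        * z ^ (m + k) / fact (m + k) * of_nat ((m + k) choose k)"
      by (simp add: poch power_add mult_ac)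
  qed
  finally show ?thesis
    by (subst (asm) sums_zero_iff_shift) (auto simp: binomial_eq_0)
qed

text \<open>
  Expanding each term of the \<open>2F2\<close> series by Chu--Vandermonde and summing over \<open>m\<close> first for each
  of the finitely many \<open>k < N\<close> produces the \<open>1F1\<close> sum; what is left is the series below, so no
  interchange of two infinite summations is involved.
\<close>
lemma hypergeo_2F2_remainder_sums:
  fixes a b c d z :: complex
  assumes "c \<notin> \<int>\<^sub>\<le>\<^sub>0" "d \<notin> \<int>\<^sub>\<le>\<^sub>0"
  shows "(\<lambda>m. pochhammer a m / pochhammer c m * z ^ m / fact m *
            (\<Sum>k\<in>{N..m}. of_nat (m choose k) * ((-1) ^ k * pochhammer (d - b) k / pochhammer d k)))
         sums (hypergeo [a, b] [c, d] z -
            (\<Sum>k<N. pochhammer a k * pochhammer (d - b) k / (pochhammer c k * pochhammer d k)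
               * ((- z) ^ k / fact k) * hypergeo [a + of_nat k] [c + of_nat k] z))"
    (is "(\<lambda>m. ?T m * ?R m) sums (?F - ?S)")
proof -
  define x where "x k = (-1) ^ k * pochhammer (d - b) k / pochhammer d k" for k
  obtain B where B: "\<And>m. norm (pochhammer b m / pochhammer d m) \<le> B ^ m"
    using norm_pochhammer_ratio_le[OF assms(2)] by blast
  have "summable (\<lambda>m. ?T m * (pochhammer b m / pochhammer d m))"
    by (rule summable_pochhammer_ratio[OF assms(1) B])
  then have F: "(\<lambda>m. ?T m * (pochhammer b m / pochhammer d m)) sums ?F"
    by (simp add: hypergeo_def summable_sums mult_ac)
  have "(\<lambda>m. \<Sum>k<N. x k * (?T m * of_nat (m choose k))) sums
      (\<Sum>k<N. x k * (pochhammer a k / pochhammer c k * (z ^ k / fact k)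
          * hypergeo [a + of_nat k] [c + of_nat k] z))"
    by (intro sums_sum sums_mult hypergeo_1F1_shift_sums assms)
  also have "(\<Sum>k<N. x k * (pochhammer a k / pochhammer c k * (z ^ k / fact k)
          * hypergeo [a + of_nat k] [c + of_nat k] z)) = ?S"
    by (intro sum.cong refl) (simp add: x_def power_minus[of z] mult_ac)
  finally have S: "(\<lambda>m. \<Sum>k<N. x k * (?T m * of_nat (m choose k))) sums ?S" .
  have "?T m * (pochhammer b m / pochhammer d m) - (\<Sum>k<N. x k * (?T m * of_nat (m choose k)))
      = ?T m * ?R m" for m
  proof -
    define y where "y k = of_nat (m choose k) * x k" for k
    have "sum y {..m} = sum y ({..<N} \<union> {N..m})"
      \<comment> \<open>For \<open>m < N\<close> the additional terms on the right vanish with the binomial coefficient.\<close>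
      by (rule sum.mono_neutral_left) (auto simp: y_def)
    also have "\<dots> = sum y {..<N} + sum y {N..m}"
      by (rule sum.union_disjoint) auto
    finally have R: "pochhammer b m / pochhammer d m - sum y {..<N} = ?R m"
      using pochhammer_ratio_expansion[OF assms(2), of b m] by (simp add: y_def x_def)
    have S: "(\<Sum>k<N. x k * (?T m * of_nat (m choose k))) = ?T m * sum y {..<N}"
      
      unfolding sum_distrib_left by (intro sum.cong) (simp_all only: y_def mult_ac)
    show ?thesis unfolding S right_diff_distrib[symmetric] R ..
  qed
  with sums_diff[OF F S] show ?thesis by simp
qed

section \<open>The asymptotic expansion\<close>

lemma hypergeo_2F2_remainder_bound:
  fixes a b c d z :: complex
  assumes c: "c \<notin> \<int>\<^sub>\<le>\<^sub>0" and d: "d \<notin> \<int>"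
  shows "\<exists>K. \<forall>n::nat. norm (hypergeo [a, b - of_nat n] [c, d - of_nat n] z -
            (\<Sum>k<N. pochhammer a k * pochhammer (d - b) k /
                  (pochhammer c k * pochhammer (d - of_nat n) k) * ((- z) ^ k / fact k) *
                hypergeo [a + of_nat k] [c + of_nat k] z))
          \<le> K / norm (pochhammer (d - of_nat n) N)"
proof -
  obtain M where M: "M \<ge> 0" "\<And>m. norm (pochhammer a m / pochhammer c m) \<le> M ^ m"
    using norm_pochhammer_ratio_le[OF c] by blast
  obtain K C where K: "K \<ge> 0" "C \<ge> 0" "\<And>n k. N \<le> k \<Longrightarrow>
      norm (pochhammer (d - b) k / pochhammer (d - of_nat n) k)
        \<le> K * C ^ k / norm (pochhammer (d - of_nat n) N)"
    using pochhammer_ratio_shift_le[OF d, of N "d - b"] by metis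
  define E where "E = (\<Sum>m. inverse (fact m) * (M * norm z * (C + 1)) ^ m)"
  have "norm (hypergeo [a, b - of_nat n] [c, d - of_nat n] z -
            (\<Sum>k<N. pochhammer a k * pochhammer (d - b) k /
                  (pochhammer c k * pochhammer (d - of_nat n) k) * ((- z) ^ k / fact k) *
                hypergeo [a + of_nat k] [c + of_nat k] z))
          \<le> K * E / norm (pochhammer (d - of_nat n) N)" (is "norm ?D \<le> _") for n
  proof -
    define L where "L = K / norm (pochhammer (d - of_nat n) N)"
    have L: "L \<ge> 0" using K by (simp add: L_def)
    define R where "R m = (\<Sum>k\<in>{N..m}. of_nat (m choose k) *
        ((-1) ^ k * pochhammer (d - b) k / pochhammer (d - of_nat n) k))" for m
    define f where "f m = pochhammer a m / pochhammer c m * z ^ m / fact m * R m" for m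
    have "d - of_nat n \<notin> \<int>\<^sub>\<le>\<^sub>0"
      using d by (metis Ints_add Ints_of_nat diff_add_cancel nonpos_Ints_Int)
    from hypergeo_2F2_remainder_sums[OF c this, where a = a and b = "b - of_nat n" and z = z and N = N]
    have "f sums ?D" by (simp add: f_def[abs_def] R_def)
    have R: "norm (R m) \<le> L * (C + 1) ^ m" for m
    proof -
      have "norm (R m) \<le> (\<Sum>k\<in>{N..m}. real (m choose k) * (L * C ^ k))"
        unfolding R_def
      proof (rule sum_norm_le)
        fix k assume "k \<in> {N..m}"
        then have "norm (pochhammer (d - b) k / pochhammer (d - of_nat n) k) \<le> L * C ^ k"
          using K(3)[of k n] by (simp add: L_def)
        then have "real (m choose k) * norm (pochhammer (d - b) k / pochhammer (d - of_nat n) k)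
            \<le> real (m choose k) * (L * C ^ k)"
          by (intro mult_left_mono) auto
        then show "norm (of_nat (m choose k) *
            ((-1) ^ k * pochhammer (d - b) k / pochhammer (d - of_nat n) k))
            \<le> real (m choose k) * (L * C ^ k)"
          by (simp add: norm_mult norm_divide norm_power)
      qed
      also have "\<dots> \<le> (\<Sum>k\<le>m. real (m choose k) * (L * C ^ k))"
        using L K(2) by (intro sum_mono2) auto
      also have "\<dots> = L * (C + 1) ^ m"
        by (simp add: binomial_ring[of C 1] sum_distrib_left mult_ac)
      finally show ?thesis .
    qed
    have sm: "summable (\<lambda>m. L * (inverse (fact m) * (M * norm z * (C + 1)) ^ m))"
      by (intro summable_mult summable_exp)
    have "norm (f m) \<le> L * (inverse (fact m) * (M * norm z * (C + 1)) ^ m)" for m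
    proof -
      have "norm (f m) = norm (pochhammer a m / pochhammer c m) * (norm z ^ m / fact m) * norm (R m)"
        by (simp add: f_def norm_mult norm_divide norm_power)
      also have "\<dots> \<le> M ^ m * (norm z ^ m / fact m) * (L * (C + 1) ^ m)"
        using M by (intro mult_mono R) auto
      finally show ?thesis by (simp only: power_mult_distrib divide_inverse mult_ac)
    qed
    from norm_suminf_le[OF this sm] have "norm ?D \<le> L * E"
      using sums_unique[OF \<open>f sums ?D\<close>] suminf_mult[OF summable_exp, of L]
      by (simp add: E_def)
    then show ?thesis by (simp add: L_def)
  qed
  then show ?thesis by blast
qed

theorem theorem4p3:
  fixes a b c d z :: complex and N :: nat
  assumes "c \<notin> \<int>\<^sub>\<le>\<^sub>0" and "d \<notin> \<int>" and "b - d \<notin> \<nat>" and "z \<noteq> 0" and "N > 0"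
  shows "(\<lambda>n::nat. hypergeo [a, b - of_nat n] [c, d - of_nat n] z -
            (\<Sum>k=0..N-1. pochhammer a k * pochhammer (d - b) k /
                  (pochhammer c k * pochhammer (d - of_nat n) k) * ((- z) ^ k / fact k) *
                hypergeo [a + of_nat k] [c + of_nat k] z))
         \<in> O[sequentially](\<lambda>n. 1 / of_nat n ^ N)"
proof -
  have range: "{0..N-1} = {..<N}" using \<open>N > 0\<close> by auto
  obtain K where K: "\<And>n::nat. norm (hypergeo [a, b - of_nat n] [c, d - of_nat n] z -
            (\<Sum>k<N. pochhammer a k * pochhammer (d - b) k /
                  (pochhammer c k * pochhammer (d - of_nat n) k) * ((- z) ^ k / fact k) *
                hypergeo [a + of_nat k] [c + of_nat k] z))
          \<le> K / norm (pochhammer (d - of_nat n) N)"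
    using hypergeo_2F2_remainder_bound[OF assms(1,2)] by blast
  have "K / norm (pochhammer (d - of_nat n) N) \<le> \<bar>K\<bar> * 2 ^ N * norm (1 / of_nat n ^ N :: complex)"
    if "n > 0" "real n \<ge> 2 * (norm d + real N)" for n :: nat
  proof -
    have "K / norm (pochhammer (d - of_nat n) N) \<le> \<bar>K\<bar> / (real n / 2) ^ N"
      using that by (intro frac_le norm_pochhammer_minus_nat_ge) auto
    then show ?thesis by (simp add: norm_divide norm_power power_divide)
  qed
  moreover have "eventually (\<lambda>n::nat. n > 0 \<and> real n \<ge> 2 * (norm d + real N)) sequentially"
    by (intro eventually_conj eventually_gt_at_top
          eventually_compose_filterlim[OF eventually_ge_at_top filterlim_real_sequentially])
  ultimately show ?thesis
    unfolding range
    by (intro bigoI[where c = "\<bar>K\<bar> * 2 ^ N"]) (blast intro: eventually_mono order_trans[OF K])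
qed

end
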